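(* Consider the subregular finite classical $\mathcal W$-algebra $\mathcal W^{cl}_{fin}(\mathfrak{sl}_3,f_{sub})$, i.e. the Poisson algebra $\mathbb C[u_1,u_2,u_3]$ with $$\{u_1,u_2\}=-2u_1,\qquad\{u_1,u_3\}=u_2^2,\qquad\{u_2,u_3\}=-2u_3,$$ and let $V=\operatorname{Span}_{\mathbb C}\{u_1,u_2,u_3\}$. For $R\in\operatorname{End}_{\mathbb C}(V)$, $R(u_i)=\sum_{j=1}^3R_{ij}u_j$ with $R_{ij}\in\mathbb C$, let $\Pi_R$ be the bivector associated with the $R$-bracket $\{u_i,u_j\}_R=\{R(u_i),u_j\}+\{u_i,R(u_j)\}$. The following three families of constant endomorphisms $R$ define constant $R$-deformations of $\mathcal W^{cl}_{fin}(\mathfrak{sl}_3,f_{sub})$. **Type I (Cartan type).** Assume $R$ is diagonal. Then $R$ defines a constant $R$-deformation if and only if $R=\operatorname{diag}(a,b,\pm a)$ with $a,b\in\mathbb C$. **Type II (upper triangular type).** Assume $R$ is upper triangular, i.e. $R_{21}=R_{31}=R_{32}=0$. Then the Jacobi identity for $\Pi_R$ is equivalent to $$R_{11}^2=R_{33}^2,\qquad R_{12}(R_{11}+R_{22})=0,\qquad R_{23}(R_{22}+R_{33})=0.$$ **Type III (mixed type).** Assume $R_{12}=R_{21}=R_{23}=R_{32}=0$. Then $R$ defines a constant $R$-deformation if and only if $R_{11}=\pm R_{33}$. In particular, any Type III$_+$ $R$-matrix (i.e. Type III with $R_{11}=R_{33}$) produces a compatible Poisson pencil.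
   Context: **$R$-bracket and $\Pi_R$.** The bracket $\{u_i,u_j\}_R:=\{R(u_i),u_j\}+\{u_i,R(u_j)\}$ is extended to $\mathbb C[u_1,u_2,u_3]$ as a skew-symmetric biderivation. In terms of odd variables $\theta_i$ corresponding to $u_i$ on $T^*[1]$ of the Slodowy slice $\cong\mathbb A^3$, $\Pi_R=\sum_{i,j}\bigl(\{R(u_i),u_j\}+\{u_i,R(u_j)\}\bigr)\theta_i\theta_j$. The Jacobi identity for $\Pi_R$ means that $\{\cdot,\cdot\}_R$ satisfies the Jacobi identity (equivalently, the Schouten bracket $[\Pi_R,\Pi_R]$ vanishes). $R$ "defines a constant $R$-deformation" if $\{\cdot,\cdot\}_R$ is a Poisson bracket. **Compatible Poisson pencil.** Writing $H$ for the original Poisson structure and $H^{mix}$ for the Poisson structure $\{\cdot,\cdot\}_R$ with $R$ of Type III$_+$, this means that $H+\epsilon H^{mix}$ is a Poisson structure for every $\epsilon\in\mathbb C$. *)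

theory Defs
  imports "HOL-Analysis.Analysis" "HOL-Library.Poly_Mapping"
begin

section \<open>The polynomial algebra in three variables\<close>

text \<open>
  Exponent vectors are finitely supported maps \<open>3 \<Rightarrow>\<^sub>0 nat\<close>, and polynomials are finitely
  supported maps from exponent vectors to coefficients, multiplied by convolution.  In the index
  type \<open>3\<close> the numerals \<open>1\<close>, \<open>2\<close>, \<open>3\<close> denote the three distinct elements (with \<open>3 = 0\<close>).
\<close>

type_synonym cpoly = "(3 \<Rightarrow>\<^sub>0 nat) \<Rightarrow>\<^sub>0 complex"

definition u :: "3 \<Rightarrow> cpoly" where
  "u i = Poly_Mapping.single (Poly_Mapping.single i 1) 1"

definition scal :: "complex \<Rightarrow> cpoly \<Rightarrow> cpoly" where
  "scal c p = Poly_Mapping.single 0 c * p"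

text \<open>The subtraction of exponents truncates at \<open>0\<close>, but then the coefficient vanishes.\<close>

definition pd :: "3 \<Rightarrow> cpoly \<Rightarrow> cpoly" where
  "pd i p = (\<Sum>m\<in>Poly_Mapping.keys p.
     Poly_Mapping.single (m - Poly_Mapping.single i 1)
       (of_nat (Poly_Mapping.lookup m i) * Poly_Mapping.lookup p m))"

section \<open>Brackets and Poisson structures\<close>

type_synonym bracket = "cpoly \<Rightarrow> cpoly \<Rightarrow> cpoly"

definition skew_biderivation :: "bracket \<Rightarrow> bool" where
  "skew_biderivation B \<longleftrightarrow>
     (\<forall>f g. B f g = - B g f) \<and>
     (\<forall>f g h. B (f + g) h = B f h + B g h) \<and>
     (\<forall>c f h. B (scal c f) h = scal c (B f h)) \<and>
     (\<forall>f g h. B (f * g) h = f * B g h + B f h * g)"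

definition jacobi :: "bracket \<Rightarrow> bool" where
  "jacobi B \<longleftrightarrow> (\<forall>f g h. B f (B g h) + B g (B h f) + B h (B f g) = 0)"

definition poisson :: "bracket \<Rightarrow> bool" where
  "poisson B \<longleftrightarrow> skew_biderivation B \<and> jacobi B"

definition compatible_pencil :: "bracket \<Rightarrow> bracket \<Rightarrow> bool" where
  "compatible_pencil H K \<longleftrightarrow>
     poisson H \<and> poisson K \<and> (\<forall>\<epsilon>. poisson (\<lambda>f g. H f g + scal \<epsilon> (K f g)))"

text \<open>
  A bivector is given by the skew matrix \<open>P\<close> of its values on the generators; \<open>biv_bracket P\<close> is
  the extension of these values to a skew-symmetric biderivation.  That it is one, that it has
  the prescribed values on generators, and that it is unique with these properties is shown in
  \<open>skew_biderivation_biv_bracket\<close>, \<open>biv_bracket_u\<close> and \<open>skew_biderivation_unique\<close> below.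
\<close>

definition biv_bracket :: "cpoly ^ 3 ^ 3 \<Rightarrow> bracket" where
  "biv_bracket P f g = (\<Sum>i\<in>UNIV. \<Sum>j\<in>UNIV. P $ i $ j * pd i f * pd j g)"

section \<open>The subregular finite W-algebra of sl(3) and its R-brackets\<close>

definition W_bivector :: "cpoly ^ 3 ^ 3" where
  "W_bivector = vector
     [vector [0,           - 2 * u 1,  (u 2)\<^sup>2],
      vector [2 * u 1,     0,          - 2 * u 3],
      vector [- ((u 2)\<^sup>2), 2 * u 3,    0]]"

definition W_bracket :: bracket where
  "W_bracket = biv_bracket W_bivector"

definition V :: "cpoly set" where
  "V = {p. \<exists>c :: complex ^ 3. p = (\<Sum>i\<in>UNIV. scal (c $ i) (u i))}"

text \<open>
  Endomorphisms of \<open>V\<close> are represented by functions on all polynomials; only their restriction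
  to \<open>V\<close> is constrained.
\<close>

definition End_V :: "(cpoly \<Rightarrow> cpoly) set" where
  "End_V = {R. (\<forall>p\<in>V. R p \<in> V) \<and> (\<forall>p\<in>V. \<forall>q\<in>V. R (p + q) = R p + R q) \<and>
               (\<forall>c. \<forall>p\<in>V. R (scal c p) = scal c (R p))}"

definition Pi_biv :: "(cpoly \<Rightarrow> cpoly) \<Rightarrow> cpoly ^ 3 ^ 3" where
  "Pi_biv R = (\<chi> i j. W_bracket (R (u i)) (u j) + W_bracket (u i) (R (u j)))"

definition R_bracket :: "(cpoly \<Rightarrow> cpoly) \<Rightarrow> bracket" where
  "R_bracket R = biv_bracket (Pi_biv R)"

definition constant_R_deformation :: "(cpoly \<Rightarrow> cpoly) \<Rightarrow> bool" where
  "constant_R_deformation R \<longleftrightarrow> poisson (R_bracket R)"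

text \<open>
  The matrix convention is \<open>R (u i) = \<Sum>j. M $ i $ j u j\<close>: the coordinates of \<open>R (u i)\<close> form
  the \<open>i\<close>-th row.
\<close>

definition has_matrix :: "(cpoly \<Rightarrow> cpoly) \<Rightarrow> complex ^ 3 ^ 3 \<Rightarrow> bool" where
  "has_matrix R M \<longleftrightarrow> (\<forall>i. R (u i) = (\<Sum>j\<in>UNIV. scal (M $ i $ j) (u j)))"

definition diag3 :: "complex \<Rightarrow> complex \<Rightarrow> complex \<Rightarrow> complex ^ 3 ^ 3" where
  "diag3 a b c = vector [vector [a, 0, 0], vector [0, b, 0], vector [0, 0, c]]"

section \<open>Basic properties\<close>

lemma pd_superset:
  assumes "finite S" "Poly_Mapping.keys p \<subseteq> S"
  shows "pd i p = (\<Sum>m\<in>S. Poly_Mapping.single (m - Poly_Mapping.single i 1)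
       (of_nat (Poly_Mapping.lookup m i) * Poly_Mapping.lookup p m))"
  unfolding pd_def
  by (rule sum.mono_neutral_left) (use assms in \<open>auto simp: in_keys_iff\<close>)

lemma pd_0 [simp]: "pd i 0 = 0"
  by (simp add: pd_def)

lemma pd_add: "pd i (p + q) = pd i p + pd i q"
proof -
  let ?S = "Poly_Mapping.keys p \<union> Poly_Mapping.keys q"
  have "Poly_Mapping.keys (p + q) \<subseteq> ?S" by (rule keys_add)
  then show ?thesis
    by (subst (1 2 3) pd_superset[of ?S])
      (auto simp: lookup_add distrib_left single_add sum.distrib)
qed

lemma pd_single: "pd i (Poly_Mapping.single m c) =
    Poly_Mapping.single (m - Poly_Mapping.single i 1) (of_nat (Poly_Mapping.lookup m i) * c)"
  by (subst pd_superset[of "{m}"]) (auto simp: lookup_single)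

lemma cpoly_induct [case_names zero single_add]:
  fixes p :: cpoly
  assumes "P 0" and "\<And>m c q. P q \<Longrightarrow> P (Poly_Mapping.single m c + q)"
  shows "P p"
proof (induction p rule: update_induct)
  case const
  then show ?case by (rule assms)
next
  case (update f a b)
  have "Poly_Mapping.update a b f = Poly_Mapping.single a b + f"
    using update.hyps
    by (intro poly_mapping_eqI)
      (auto simp: lookup_update lookup_add lookup_single in_keys_iff when_def)
  with update assms(2) show ?case by simp
qed

lemma pd_mult_single:
  fixes m n :: "3 \<Rightarrow>\<^sub>0 nat" and a b :: complex
  defines "p \<equiv> Poly_Mapping.single m a" and "q \<equiv> Poly_Mapping.single n b"
  shows "pd i (p * q) = p * pd i q + pd i p * q"
proof -
  let ?e = "Poly_Mapping.single i (1::nat)"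
  have sh: "(x + y) - ?e = x + (y - ?e)" if "Poly_Mapping.lookup y i \<noteq> 0" for x y
    using that by (intro poly_mapping_eqI)
      (auto simp: lookup_add lookup_minus lookup_single when_def)
  have 1: "Poly_Mapping.single (m + n - ?e) (of_nat (Poly_Mapping.lookup n i) * (a * b))
      = Poly_Mapping.single (m + (n - ?e)) (of_nat (Poly_Mapping.lookup n i) * (a * b))"
    by (cases "Poly_Mapping.lookup n i = 0") (simp_all add: sh del: One_nat_def)
  have 2: "Poly_Mapping.single (m + n - ?e) (of_nat (Poly_Mapping.lookup m i) * (a * b))
      = Poly_Mapping.single (m - ?e + n) (of_nat (Poly_Mapping.lookup m i) * (a * b))"
    using sh[of m n] by (cases "Poly_Mapping.lookup m i = 0") (simp_all add: add.commute del: One_nat_def)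
  have "pd i (p * q) =
      Poly_Mapping.single (m + n - ?e) (of_nat (Poly_Mapping.lookup n i) * (a * b))
    + Poly_Mapping.single (m + n - ?e) (of_nat (Poly_Mapping.lookup m i) * (a * b))"
    by (simp add: p_def q_def mult_single pd_single lookup_add algebra_simps single_add[symmetric])
  then show ?thesis
    unfolding 1 2 by (simp add: p_def q_def mult_single pd_single algebra_simps)
qed

lemma pd_mult: "pd i (p * q) = p * pd i q + pd i p * q"
proof (induction p rule: cpoly_induct)
  case zero
  then show ?case by simp
next
  case (single_add m c p)
  have "pd i (Poly_Mapping.single m c * q) =
      Poly_Mapping.single m c * pd i q + pd i (Poly_Mapping.single m c) * q"
    by (induction q rule: cpoly_induct)
      (simp_all add: distrib_left distrib_right pd_add pd_mult_single[simplified] algebra_simps)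
  with single_add show ?case by (simp add: distrib_right pd_add algebra_simps)
qed

lemma pd_scal: "pd i (scal c p) = scal c (pd i p)"
  by (simp add: scal_def pd_mult pd_single)

lemma pd_u: "pd i (u j) = (if i = j then 1 else 0)"
  by (auto simp: u_def pd_single lookup_single)

lemma biv_bracket_u: "biv_bracket P (u i) (u j) = P $ i $ j"
proof -
  have "biv_bracket P (u i) (u j)
      = (\<Sum>k\<in>UNIV. \<Sum>l\<in>UNIV. if l = j then if k = i then P $ k $ l else 0 else 0)"
    unfolding biv_bracket_def by (intro sum.cong refl) (auto simp: pd_u)
  then show ?thesis by simp
qed

lemma skew_biderivation_biv_bracket:
  assumes "\<And>i j. P $ i $ j = - P $ j $ i"
  shows "skew_biderivation (biv_bracket P)"
  unfolding skew_biderivation_def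
proof (intro conjI allI)
  fix f g h :: cpoly and c :: complex
  have "biv_bracket P f g = (\<Sum>j\<in>UNIV. \<Sum>i\<in>UNIV. P $ i $ j * pd i f * pd j g)"
    unfolding biv_bracket_def by (rule sum.swap)
  also have "\<dots> = (\<Sum>j\<in>UNIV. \<Sum>i\<in>UNIV. - (P $ j $ i * pd j g * pd i f))"
  proof (intro sum.cong refl)
    fix i j
    show "P $ i $ j * pd i f * pd j g = - (P $ j $ i * pd j g * pd i f)"
      by (subst assms) (simp add: algebra_simps)
  qed
  also have "\<dots> = - biv_bracket P g f"
    by (simp add: biv_bracket_def sum_negf)
  finally show "biv_bracket P f g = - biv_bracket P g f" .
  show "biv_bracket P (f + g) h = biv_bracket P f h + biv_bracket P g h"
    by (simp add: biv_bracket_def pd_add algebra_simps sum.distrib)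
  show "biv_bracket P (scal c f) h = scal c (biv_bracket P f h)"
    by (simp add: biv_bracket_def pd_scal) (simp add: scal_def sum_distrib_left algebra_simps)
  show "biv_bracket P (f * g) h = f * biv_bracket P g h + biv_bracket P f h * g"
    by (simp add: biv_bracket_def pd_mult algebra_simps sum.distrib sum_distrib_left)
qed

lemma derivation_unique:
  fixes D :: "cpoly \<Rightarrow> cpoly"
  assumes add: "\<And>f g. D (f + g) = D f + D g"
    and scal: "\<And>c f. D (scal c f) = scal c (D f)"
    and mult: "\<And>f g. D (f * g) = f * D g + D f * g"
  shows "D f = (\<Sum>i\<in>UNIV. D (u i) * pd i f)"
proof -
  define E where "E f = D f - (\<Sum>i\<in>UNIV. D (u i) * pd i f)" for f
  have E_add: "E (f + g) = E f + E g" for f g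
    by (simp add: E_def add pd_add algebra_simps sum.distrib)
  have E_scal: "E (scal c f) = scal c (E f)" for c f
    by (simp add: E_def scal pd_scal) (simp add: scal_def algebra_simps sum_distrib_left)
  have E_mult: "E (f * g) = f * E g + E f * g" for f g
    by (simp add: E_def mult pd_mult algebra_simps sum.distrib sum_distrib_left)
  have E_u: "E (u i) = 0" for i
  proof -
    have "(\<Sum>k\<in>UNIV. D (u k) * pd k (u i)) = (\<Sum>k\<in>UNIV. if k = i then D (u k) else 0)"
      by (intro sum.cong refl) (auto simp: pd_u)
    then show ?thesis by (simp add: E_def)
  qed
  have E1: "E 1 = 0" using E_mult[of 1 1] by simp
  have E_pow: "E (u i ^ n) = 0" for i n
    by (induction n) (simp_all add: E1 E_mult E_u)
  have u_pow: "u i ^ n = Poly_Mapping.single (Poly_Mapping.single i n) 1" for i n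
    by (induction n) (simp_all add: u_def mult_single single_add[symmetric])
  have mono: "Poly_Mapping.single m c = scal c (u 1 ^ Poly_Mapping.lookup m 1 *
      (u 2 ^ Poly_Mapping.lookup m 2 * u 3 ^ Poly_Mapping.lookup m 3))" for m c
  proof -
    have "m = Poly_Mapping.single 1 (Poly_Mapping.lookup m 1) +
      (Poly_Mapping.single 2 (Poly_Mapping.lookup m 2) +
       Poly_Mapping.single 3 (Poly_Mapping.lookup m 3))"
      by (rule poly_mapping_eqI) (use exhaust_3 in \<open>auto simp: lookup_add lookup_single when_def\<close>)
    then show ?thesis by (simp add: u_pow scal_def mult_single)
  qed
  have "E f = 0"
  proof (induction f rule: cpoly_induct)
    case zero
    show ?case using E_add[of 0 0] by simp
  next
    case (single_add m c q)
    then show ?case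
      unfolding E_add mono E_scal E_mult E_pow by (simp add: scal_def)
  qed
  then show ?thesis by (simp add: E_def)
qed

lemma skew_biderivation_unique:
  assumes "skew_biderivation B"
  shows "B = biv_bracket (\<chi> i j. B (u i) (u j))"
proof (intro ext)
  fix f g
  have skew: "\<And>f g. B f g = - B g f"
    and der: "\<And>f g h. B (f + g) h = B f h + B g h"
      "\<And>c f h. B (scal c f) h = scal c (B f h)"
      "\<And>f g h. B (f * g) h = f * B g h + B f h * g"
    using assms unfolding skew_biderivation_def by blast+
  have D: "B f h = (\<Sum>i\<in>UNIV. B (u i) h * pd i f)" for f h
    by (rule derivation_unique) (rule der)+
  have "B (u i) g = (\<Sum>j\<in>UNIV. B (u i) (u j) * pd j g)" for i
    by (subst skew, subst D, subst (2) skew) (simp add: sum_negf)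
  then have "B f g = (\<Sum>i\<in>UNIV. (\<Sum>j\<in>UNIV. B (u i) (u j) * pd j g) * pd i f)"
    by (subst D) simp
  then show "B f g = biv_bracket (\<chi> i j. B (u i) (u j)) f g"
    by (simp add: biv_bracket_def sum_distrib_left sum_distrib_right mult_ac)
qed

lemma W_bracket_u:
  "W_bracket (u 1) (u 2) = - 2 * u 1"
  "W_bracket (u 1) (u 3) = (u 2)\<^sup>2"
  "W_bracket (u 2) (u 3) = - 2 * u 3"
  by (simp_all add: W_bracket_def biv_bracket_u W_bivector_def)

lemma skew_biderivation_W_bracket: "skew_biderivation W_bracket"
  unfolding W_bracket_def
proof (rule skew_biderivation_biv_bracket)
  fix i j :: 3
  show "W_bivector $ i $ j = - W_bivector $ j $ i"
    using exhaust_3[of i] exhaust_3[of j] by (auto simp: W_bivector_def)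
qed

lemma skew_biderivation_R_bracket: "skew_biderivation (R_bracket R)"
  unfolding R_bracket_def
proof (rule skew_biderivation_biv_bracket)
  have skew: "W_bracket f g = - W_bracket g f" for f g
    using skew_biderivation_W_bracket unfolding skew_biderivation_def by blast
  fix i j :: 3
  show "Pi_biv R $ i $ j = - Pi_biv R $ j $ i"
    using skew[of "R (u i)" "u j"] skew[of "u i" "R (u j)"] by (simp add: Pi_biv_def)
qed

end

(*
The Jacobiator of a skew-symmetric biderivation on three generators is an alternating
triderivation, so the Jacobi identity amounts to its vanishing on (u 1, u 2, u 3).  Writing
a = {u 2, u 3}, b = {u 3, u 1}, c = {u 1, u 2}, this says that (a, b, c) is orthogonal to its curl.
All brackets considered here have a, b, c in the span of u 1, (u 2)^2, u 3, and comparing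
coefficients turns orthogonality into five quadratic equations.
*)
theory Submission
  imports Defs
begin

section \<open>Calculus of skew-symmetric biderivations\<close>

lemma skew_biderivationD:
  assumes "skew_biderivation B"
  shows "B f g = - B g f"
    and "B (f + g) h = B f h + B g h"
    and "B (scal c f) h = scal c (B f h)"
    and "B (f * g) h = f * B g h + B f h * g"
  using assms unfolding skew_biderivation_def by blast+

text \<open>Coefficientwise, 2 is invertible; this turns skew symmetry into vanishing on repeated
  arguments.\<close>

lemma cpoly_eq_neg_self:
  fixes p :: cpoly
  assumes "p = - p"
  shows "p = 0"
proof (rule poly_mapping_eqI)
  fix k
  have "Poly_Mapping.lookup p k = - Poly_Mapping.lookup p k"
    by (subst assms) simp
  then show "Poly_Mapping.lookup p k = Poly_Mapping.lookup 0 k"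
    by simp
qed

text \<open>Skew symmetry carries the rules for the first slot over to the second.\<close>

lemma skew_biderivation_simps:
  assumes "skew_biderivation B"
  shows "B h (f + g) = B h f + B h g"
    and "B h (scal c f) = scal c (B h f)"
    and "B h (f * g) = f * B h g + B h f * g"
    and "B h (- f) = - B h f"
    and "B (- f) h = - B f h"
    and "B f f = 0"
    and "B h (f - g) = B h f - B h g"
proof -
  note sk = skew_biderivationD[OF assms]
  show add: "B h (f + g) = B h f + B h g" for f g
    using sk(1)[of h "f + g"] sk(1)[of h f] sk(1)[of h g] sk(2)[of f g h] by simp
  show "B h (scal c f) = scal c (B h f)"
    using sk(1)[of h "scal c f"] sk(1)[of h f] sk(3)[of c f h] by (simp add: scal_def)
  show "B h (f * g) = f * B h g + B h f * g"
    using sk(1)[of h "f * g"] sk(1)[of h f] sk(1)[of h g] sk(4)[of f g h] by simp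
  have "B h 0 = 0"
    using add[where f = 0 and g = 0] by simp
  then show neg: "B h (- f) = - B h f"
    using add by (metis add.inverse_unique add.right_inverse)
  show "B h (f - g) = B h f - B h g"
    using add[of "f - g" g] by simp
  show "B (- f) h = - B f h"
    using neg sk(1) by metis
  show "B f f = 0"
    using sk(1)[of f f] by (rule cpoly_eq_neg_self)
qed

section \<open>Reduction of the Jacobi identity to the generators\<close>

definition jacobiator :: "bracket \<Rightarrow> cpoly \<Rightarrow> cpoly \<Rightarrow> cpoly \<Rightarrow> cpoly" where
  "jacobiator B f g h = B f (B g h) + B g (B h f) + B h (B f g)"

lemma jacobiator_cycle: "jacobiator B f g h = jacobiator B g h f"
  by (simp add: jacobiator_def add_ac)

text \<open>Flipping the three inner brackets turns one cyclic sum into minus the other. With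
  \<open>jacobiator_cycle\<close> this gives all signs under permutation.\<close>

lemma jacobiator_swap:
  assumes "skew_biderivation B"
  shows "jacobiator B f h g = - jacobiator B f g h"
proof -
  note skew = skew_biderivationD(1)[OF assms]
  have "jacobiator B f h g = B f (- B g h) + B h (- B f g) + B g (- B h f)"
    unfolding jacobiator_def by (subst (2) skew, subst (4) skew, subst (6) skew) simp
  then show ?thesis
    by (simp add: jacobiator_def skew_biderivation_simps(4)[OF assms])
qed

text \<open>In the Leibniz expansion of the iterated brackets, the products of two single brackets
  cancel in pairs, so the first slot is a derivation and \<open>derivation_unique\<close>
  applies.\<close>

lemma jacobiator_derivation:
  assumes "skew_biderivation B"
  shows "jacobiator B f g h = (\<Sum>i\<in>UNIV. jacobiator B (u i) g h * pd i f)"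
proof (rule derivation_unique)
  note sk = skew_biderivationD(2-)[OF assms] skew_biderivation_simps[OF assms]
  fix c f f'
  show "jacobiator B (f + f') g h = jacobiator B f g h + jacobiator B f' g h"
    by (simp add: jacobiator_def sk)
  show "jacobiator B (scal c f) g h = scal c (jacobiator B f g h)"
    by (simp add: jacobiator_def sk) (simp add: scal_def algebra_simps)
  \<comment> \<open>Orienting these brackets uniformly makes the cross terms cancel, for instance
    \<open>B g f * B h f'\<close> against \<open>B f g * B h f'\<close>.\<close>
  have "B h f = - B f h" "B h f' = - B f' h"
    by (rule skew_biderivationD(1)[OF assms])+
  then show "jacobiator B (f * f') g h = f * jacobiator B f' g h + jacobiator B f g h * f'"
    unfolding jacobiator_def
    using skew_biderivationD(1)[OF assms, of g f] skew_biderivationD(1)[OF assms, of g f']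
    by (simp add: sk algebra_simps)
qed

lemma jacobi_iff_jacobiator_generators:
  assumes "skew_biderivation B"
  shows "jacobi B \<longleftrightarrow> jacobiator B (u 1) (u 2) (u 3) = 0"
proof
  assume "jacobi B"
  then show "jacobiator B (u 1) (u 2) (u 3) = 0"
    by (simp add: jacobi_def jacobiator_def)
next
  note cyc = jacobiator_cycle[of B] and swap = jacobiator_swap[OF assms]
  assume J: "jacobiator B (u 1) (u 2) (u 3) = 0"
  have rep: "jacobiator B f f g = 0" for f g
    using cyc swap by (metis cpoly_eq_neg_self)
  have rep': "jacobiator B f g f = 0" "jacobiator B g f f = 0" for f g
    using rep[of f g] cyc by metis+
  have J': "jacobiator B (u 2) (u 3) (u 1) = 0" "jacobiator B (u 3) (u 1) (u 2) = 0"
    "jacobiator B (u 1) (u 3) (u 2) = 0" "jacobiator B (u 3) (u 2) (u 1) = 0"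
    "jacobiator B (u 2) (u 1) (u 3) = 0"
    using J cyc swap by (metis neg_equal_0_iff_equal)+
  \<comment> \<open>A triple of indices either repeats an entry or is a permutation of 1, 2,
    3.\<close>
  have gen: "jacobiator B (u i) (u j) (u k) = 0" for i j k
    using exhaust_3[of i] exhaust_3[of j] exhaust_3[of k] J J' by (auto simp: rep rep')
  \<comment> \<open>Arguments are freed one at a time: \<open>jacobiator_derivation\<close> frees
    the first slot, then the symmetries move the arbitrary polynomial further back.\<close>
  have "jacobiator B f (u j) (u k) = 0" for f j k
    by (subst jacobiator_derivation[OF assms]) (simp add: gen)
  then have "jacobiator B (u i) f (u k) = 0" for i f k
    using cyc swap by (metis neg_equal_0_iff_equal)
  then have "jacobiator B f g (u k) = 0" for f g k
    by (subst jacobiator_derivation[OF assms]) simp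
  then have "jacobiator B (u i) f g = 0" for i f g
    using cyc by metis
  then have "jacobiator B f g h = 0" for f g h
    by (subst jacobiator_derivation[OF assms]) simp
  then show "jacobi B"
    by (simp add: jacobi_def jacobiator_def)
qed

lemma skew_biderivation_generator:
  assumes "skew_biderivation B"
  shows "B (u i) f = (\<Sum>j\<in>UNIV. B (u i) (u j) * pd j f)"
  by (rule derivation_unique) (rule skew_biderivation_simps[OF assms])+

text \<open>Expanding the outer brackets in partial derivatives turns the jacobiator of the
  generators into minus the product of (a, b, c) with its curl; the cyclic order \<open>u 3\<close>,
  \<open>u 1\<close> in b fixes the signs.\<close>

lemma jacobi_iff_curl:
  assumes "skew_biderivation B"
    and a: "B (u 2) (u 3) = a" and b: "B (u 3) (u 1) = b" and c: "B (u 1) (u 2) = c"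
  shows "jacobi B \<longleftrightarrow>
    a * (pd 2 c - pd 3 b) + b * (pd 3 a - pd 1 c) + c * (pd 1 b - pd 2 a) = 0"
proof -
  note skew = skew_biderivationD(1)[OF assms(1)]
  have n: "B (u 3) (u 2) = - a" "B (u 1) (u 3) = - b" "B (u 2) (u 1) = - c"
    using a b c skew by metis+
  have "jacobiator B (u 1) (u 2) (u 3) =
      - (a * (pd 2 c - pd 3 b) + b * (pd 3 a - pd 1 c) + c * (pd 1 b - pd 2 a))"
    unfolding jacobiator_def a b c
    by (simp add: skew_biderivation_generator[OF assms(1), of _ a]
        skew_biderivation_generator[OF assms(1), of _ b]
        skew_biderivation_generator[OF assms(1), of _ c]
        sum_3 a b c n skew_biderivation_simps(6)[OF assms(1)] algebra_simps)
  then show ?thesis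
    using jacobi_iff_jacobiator_generators[OF assms(1)] by (metis neg_equal_0_iff_equal)
qed

section \<open>Comparison of coefficients\<close>

lemma scal_simps:
  "scal (c + d) p = scal c p + scal d p"
  "scal (c - d) p = scal c p - scal d p"
  "scal (- c) p = - scal c p"
  "scal c (p + q) = scal c p + scal c q"
  "scal c (p - q) = scal c p - scal c q"
  "scal c (- p) = - scal c p"
  "scal c (scal d p) = scal (c * d) p"
  "scal c p * q = scal c (p * q)"
  "p * scal c q = scal c (p * q)"
  "scal 0 p = 0"
  "scal c 0 = 0"
  "scal 1 p = p"
  by (simp_all add: scal_def single_add single_diff single_uminus algebra_simps mult_single)

lemma scal_numeral: "scal (numeral n) p = numeral n * p"
  by (simp add: scal_def)

lemma lookup_scal_monomial:
  "Poly_Mapping.lookup (scal c (Poly_Mapping.single m 1)) k = (if k = m then c else 0)"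
  by (simp add: scal_def mult_single lookup_single when_def)

text \<open>These are the five monomials that survive in the product with the curl; their exponent
  vectors are pairwise distinct, so each coefficient can be read off.\<close>

lemma scal_monomials_eq_0_iff:
  "scal p (u 1) + scal q (u 3) + scal r ((u 2)\<^sup>2) + scal s (u 1 * u 2) + scal t (u 2 * u 3) = 0
    \<longleftrightarrow> p = 0 \<and> q = 0 \<and> r = 0 \<and> s = 0 \<and> t = 0" (is "?f = 0 \<longleftrightarrow> _")
proof
  let ?e = "\<lambda>i. Poly_Mapping.single i (1::nat) :: 3 \<Rightarrow>\<^sub>0 nat"
  assume "?f = 0"
  then have z: "Poly_Mapping.lookup ?f m = 0" for m by simp
  have uu: "u i = Poly_Mapping.single (?e i) 1" "u i * u j = Poly_Mapping.single (?e i + ?e j) 1"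
    "(u i)\<^sup>2 = Poly_Mapping.single (?e i + ?e i) 1" for i j
    by (simp_all add: u_def mult_single power2_eq_square)
  have ne: "?e 1 \<noteq> ?e 3" "?e 1 \<noteq> ?e 2 + ?e 2" "?e 1 \<noteq> ?e 1 + ?e 2" "?e 1 \<noteq> ?e 2 + ?e 3"
    "?e 3 \<noteq> ?e 2 + ?e 2" "?e 3 \<noteq> ?e 1 + ?e 2" "?e 3 \<noteq> ?e 2 + ?e 3"
    "?e 2 + ?e 2 \<noteq> ?e 1 + ?e 2" "?e 2 + ?e 2 \<noteq> ?e 2 + ?e 3" "?e 1 + ?e 2 \<noteq> ?e 2 + ?e 3"
    by (simp_all add: poly_mapping_eq_iff fun_eq_iff forall_3 lookup_add lookup_single)
  show "p = 0 \<and> q = 0 \<and> r = 0 \<and> s = 0 \<and> t = 0"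
    using z[of "?e 1"] z[of "?e 3"] z[of "?e 2 + ?e 2"] z[of "?e 1 + ?e 2"] z[of "?e 2 + ?e 3"]
    \<comment> \<open>Products and squares must be rewritten first, since unfolding
      \<open>u i\<close> would destroy their patterns.\<close>
    unfolding uu(2,3) unfolding uu(1)
    by (simp only: lookup_add lookup_scal_monomial ne ne[symmetric] if_True if_False) simp
next
  assume "p = 0 \<and> q = 0 \<and> r = 0 \<and> s = 0 \<and> t = 0"
  then show "?f = 0" by (simp add: scal_simps)
qed

lemma jacobi_iff_coefficients:
  assumes "skew_biderivation B"
    and a: "B (u 2) (u 3) = scal a1 (u 1) + scal a2 ((u 2)\<^sup>2) + scal a3 (u 3)"
    and b: "B (u 3) (u 1) = scal b1 (u 1) + scal b2 ((u 2)\<^sup>2) + scal b3 (u 3)"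
    and c: "B (u 1) (u 2) = scal c1 (u 1) + scal c2 ((u 2)\<^sup>2) + scal c3 (u 3)"
  shows "jacobi B \<longleftrightarrow> a3 * b1 = a1 * b3 \<and> b1 * c3 = b3 * c1 \<and>
    b2 * (a3 - c1) + b1 * c2 = a2 * b3 \<and> a1 * c2 = a2 * c1 \<and> a3 * c2 = a2 * c3"
proof -
  let ?a = "scal a1 (u 1) + scal a2 ((u 2)\<^sup>2) + scal a3 (u 3)"
  let ?b = "scal b1 (u 1) + scal b2 ((u 2)\<^sup>2) + scal b3 (u 3)"
  let ?c = "scal c1 (u 1) + scal c2 ((u 2)\<^sup>2) + scal c3 (u 3)"
  have pd: "pd 1 (scal x (u 1) + scal y ((u 2)\<^sup>2) + scal z (u 3)) = scal x 1"
    "pd 2 (scal x (u 1) + scal y ((u 2)\<^sup>2) + scal z (u 3)) = scal y (2 * u 2)"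
    "pd 3 (scal x (u 1) + scal y ((u 2)\<^sup>2) + scal z (u 3)) = scal z 1" for x y z
    by (simp_all add: pd_add pd_scal pd_mult pd_u power2_eq_square scal_simps)
  \<comment> \<open>Constants embed as a ring homomorphism, so coefficient arithmetic becomes ring
    arithmetic in \<open>cpoly\<close>.\<close>
  have K: "(Poly_Mapping.single 0 (x + y) :: cpoly) = Poly_Mapping.single 0 x + Poly_Mapping.single 0 y"
    "(Poly_Mapping.single 0 (x - y) :: cpoly) = Poly_Mapping.single 0 x - Poly_Mapping.single 0 y"
    "(Poly_Mapping.single 0 (x * y) :: cpoly) = Poly_Mapping.single 0 x * Poly_Mapping.single 0 y"
    "(Poly_Mapping.single 0 (numeral n) :: cpoly) = numeral n"
    for x y :: complex and n
    by (simp_all add: single_add single_diff mult_single)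
  \<comment> \<open>The terms in \<open>u 2 ^ 3\<close> cancel: \<open>2 * a2 * c2\<close> arises
    from \<open>?a\<close> and, with opposite sign, from \<open>?c\<close>.\<close>
  have "?a * (pd 2 ?c - pd 3 ?b) + ?b * (pd 3 ?a - pd 1 ?c) + ?c * (pd 1 ?b - pd 2 ?a) =
      scal (a3 * b1 - a1 * b3) (u 1) + scal (b1 * c3 - b3 * c1) (u 3) +
      scal (b2 * (a3 - c1) + b1 * c2 - a2 * b3) ((u 2)\<^sup>2) +
      scal (2 * (a1 * c2 - a2 * c1)) (u 1 * u 2) + scal (2 * (a3 * c2 - a2 * c3)) (u 2 * u 3)"
    unfolding pd unfolding scal_def K by (simp add: algebra_simps power2_eq_square)
  then show ?thesis
    unfolding jacobi_iff_curl[OF assms] by (simp only: scal_monomials_eq_0_iff) auto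
qed

section \<open>The R-brackets of the W-algebra\<close>

lemma W_bracket_generators:
  "W_bracket (u 1) (u 1) = 0" "W_bracket (u 2) (u 2) = 0" "W_bracket (u 3) (u 3) = 0"
  "W_bracket (u 1) (u 2) = scal (- 2) (u 1)" "W_bracket (u 2) (u 1) = scal 2 (u 1)"
  "W_bracket (u 1) (u 3) = (u 2)\<^sup>2" "W_bracket (u 3) (u 1) = - (u 2)\<^sup>2"
  "W_bracket (u 2) (u 3) = scal (- 2) (u 3)" "W_bracket (u 3) (u 2) = scal 2 (u 3)"
  by (simp_all add: W_bracket_def biv_bracket_u W_bivector_def scal_numeral scal_simps)

text \<open>Constant linear combinations of generators keep all brackets in the span of
  \<open>u 1\<close>, \<open>(u 2)\<^sup>2\<close>, \<open>u 3\<close>, the form needed by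
  \<open>jacobi_iff_coefficients\<close>.\<close>

lemma R_bracket_generators:
  assumes "has_matrix R M"
  shows "R_bracket R (u 2) (u 3) = scal (2 * M $ 3 $ 1) (u 1) + scal (M $ 2 $ 1) ((u 2)\<^sup>2) +
      scal (- 2 * (M $ 2 $ 2 + M $ 3 $ 3)) (u 3)"
    and "R_bracket R (u 3) (u 1) = scal (2 * M $ 3 $ 2) (u 1) +
      scal (- (M $ 1 $ 1 + M $ 3 $ 3)) ((u 2)\<^sup>2) + scal (2 * M $ 1 $ 2) (u 3)"
    and "R_bracket R (u 1) (u 2) = scal (- 2 * (M $ 1 $ 1 + M $ 2 $ 2)) (u 1) +
      scal (M $ 2 $ 3) ((u 2)\<^sup>2) + scal (2 * M $ 1 $ 3) (u 3)"
proof -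
  note W = skew_biderivation_W_bracket
  have R: "R (u i) = scal (M $ i $ 1) (u 1) + scal (M $ i $ 2) (u 2) + scal (M $ i $ 3) (u 3)" for i
    using assms by (simp add: has_matrix_def sum_3)
  note simps = R_bracket_def biv_bracket_u Pi_biv_def R skew_biderivationD(2,3)[OF W]
    skew_biderivation_simps(1,2)[OF W] W_bracket_generators scal_simps
  show "R_bracket R (u 2) (u 3) = scal (2 * M $ 3 $ 1) (u 1) + scal (M $ 2 $ 1) ((u 2)\<^sup>2) +
      scal (- 2 * (M $ 2 $ 2 + M $ 3 $ 3)) (u 3)"
    "R_bracket R (u 3) (u 1) = scal (2 * M $ 3 $ 2) (u 1) +
      scal (- (M $ 1 $ 1 + M $ 3 $ 3)) ((u 2)\<^sup>2) + scal (2 * M $ 1 $ 2) (u 3)"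
    "R_bracket R (u 1) (u 2) = scal (- 2 * (M $ 1 $ 1 + M $ 2 $ 2)) (u 1) +
      scal (M $ 2 $ 3) ((u 2)\<^sup>2) + scal (2 * M $ 1 $ 3) (u 3)"
    by (simp_all add: simps algebra_simps)
qed

text \<open>No shape is imposed on \<open>M\<close>: all three types are specialisations of this
  criterion. In the third equation \<open>M $ 2 $ 2\<close> cancels and a difference of squares
  remains.\<close>

lemma jacobi_R_bracket_iff:
  assumes "has_matrix R M"
  shows "jacobi (R_bracket R) \<longleftrightarrow>
    M $ 3 $ 2 * (M $ 2 $ 2 + M $ 3 $ 3) + M $ 3 $ 1 * M $ 1 $ 2 = 0 \<and>
    M $ 1 $ 2 * (M $ 1 $ 1 + M $ 2 $ 2) + M $ 1 $ 3 * M $ 3 $ 2 = 0 \<and>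
    (M $ 1 $ 1)\<^sup>2 + M $ 1 $ 2 * M $ 2 $ 1 = (M $ 3 $ 3)\<^sup>2 + M $ 2 $ 3 * M $ 3 $ 2 \<and>
    M $ 2 $ 1 * (M $ 1 $ 1 + M $ 2 $ 2) + M $ 3 $ 1 * M $ 2 $ 3 = 0 \<and>
    M $ 2 $ 3 * (M $ 2 $ 2 + M $ 3 $ 3) + M $ 1 $ 3 * M $ 2 $ 1 = 0"
proof -
  \<comment> \<open>Each coefficient equation is a nonzero constant multiple of the stated one;
    \<open>k\<close> is that constant.\<close>
  have eq: "x = y \<longleftrightarrow> x' = y'" if "x - y = k * (x' - y')" "k \<noteq> 0" for x y x' y' k :: complex
    using that by (metis mult_eq_0_iff right_minus_eq)
  show ?thesis
    unfolding jacobi_iff_coefficients[OF skew_biderivation_R_bracket R_bracket_generators[OF assms]]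
    apply (intro conj_cong)
    subgoal by (rule eq[of _ _ "- 4"]) (simp_all add: algebra_simps)
    subgoal by (rule eq[of _ _ 4]) (simp_all add: algebra_simps)
    subgoal by (rule eq[of _ _ "- 2"]) (simp_all add: algebra_simps power2_eq_square)
    subgoal by (rule eq[of _ _ 2]) (simp_all add: algebra_simps)
    subgoal by (rule eq[of _ _ "- 2"]) (simp_all add: algebra_simps)
    done
qed

section \<open>The original Poisson structure and its pencil\<close>

lemma poisson_W_bracket: "poisson W_bracket"
proof -
  have "jacobi W_bracket \<longleftrightarrow> True"
    \<comment> \<open>The coefficients of -2 \<open>u 3\<close>, -\<open>(u 2)\<^sup>2\<close> and
      -2 \<open>u 1\<close>; the only equation not trivially true holds because
      \<open>a3 = c1\<close>.\<close>
    by (subst jacobi_iff_coefficients[of _ 0 0 "- 2" 0 "- 1" 0 "- 2" 0 0])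
      (simp_all add: skew_biderivation_W_bracket W_bracket_generators scal_simps)
  then show ?thesis
    by (simp add: poisson_def skew_biderivation_W_bracket)
qed

lemma skew_biderivation_pencil:
  assumes "skew_biderivation H" "skew_biderivation K"
  shows "skew_biderivation (\<lambda>f g. H f g + scal \<epsilon> (K f g))"
  unfolding skew_biderivation_def
proof (intro conjI allI)
  fix f g h :: cpoly and c
  show "H f g + scal \<epsilon> (K f g) = - (H g f + scal \<epsilon> (K g f))"
    using skew_biderivationD(1)[OF assms(1), of f g] skew_biderivationD(1)[OF assms(2), of f g]
    by (simp add: scal_simps)
qed (simp_all add: skew_biderivationD(2-)[OF assms(1)] skew_biderivationD(2-)[OF assms(2)]
    scal_simps algebra_simps)

text \<open>All of \<open>a2\<close>, \<open>b1\<close>, \<open>b3\<close>, \<open>c2\<close> vanish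
  along the pencil, which leaves \<open>b2 * (a3 - c1) = 0\<close>. Equality of the corner entries
  keeps \<open>a3 = c1\<close> for every \<epsilon>.\<close>

lemma compatible_pencil_R_bracket:
  assumes M: "has_matrix R M"
    and "M $ 1 $ 2 = 0" "M $ 2 $ 1 = 0" "M $ 2 $ 3 = 0" "M $ 3 $ 2 = 0" "M $ 1 $ 1 = M $ 3 $ 3"
  shows "compatible_pencil W_bracket (R_bracket R)"
  unfolding compatible_pencil_def
proof (intro conjI allI)
  show "poisson W_bracket" by (rule poisson_W_bracket)
  show "poisson (R_bracket R)"
    using assms by (simp add: poisson_def skew_biderivation_R_bracket jacobi_R_bracket_iff[OF M])
  fix \<epsilon>
  \<comment> \<open>The common value of \<open>a3\<close> and \<open>c1\<close>.\<close>
  let ?s = "- 2 * (1 + \<epsilon> * (M $ 2 $ 2 + M $ 3 $ 3))"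
  let ?B = "\<lambda>f g. W_bracket f g + scal \<epsilon> (R_bracket R f g)"
  have skew: "skew_biderivation ?B"
    by (intro skew_biderivation_pencil skew_biderivation_W_bracket skew_biderivation_R_bracket)
  have "jacobi ?B \<longleftrightarrow> True"
    by (subst jacobi_iff_coefficients[OF skew, of "\<epsilon> * (2 * M $ 3 $ 1)" 0 ?s
          0 "- 1 - \<epsilon> * (M $ 1 $ 1 + M $ 3 $ 3)" 0 ?s 0 "\<epsilon> * (2 * M $ 1 $ 3)"])
      (simp_all add: R_bracket_generators[OF M] W_bracket_generators assms(2-)
        scal_simps algebra_simps)
  with skew show "poisson ?B" by (simp add: poisson_def)
qed

section \<open>The three types of R-matrices\<close>

lemma diag3_iff:
  assumes "\<And>i j. i \<noteq> j \<Longrightarrow> M $ i $ j = 0"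
  shows "(\<exists>a b. M = diag3 a b a \<or> M = diag3 a b (- a)) \<longleftrightarrow>
    M $ 1 $ 1 = M $ 3 $ 3 \<or> M $ 1 $ 1 = - M $ 3 $ 3"
proof -
  have "M = diag3 a b c \<longleftrightarrow> M $ 1 $ 1 = a \<and> M $ 2 $ 2 = b \<and> M $ 3 $ 3 = c" for a b c
    using assms by (auto simp: vec_eq_iff forall_3 diag3_def)
  then show ?thesis by (auto simp: eq_neg_iff_add_eq_0 add.commute)
qed

theorem proposition5p7:
  fixes R :: "cpoly \<Rightarrow> cpoly" and M :: "complex ^ 3 ^ 3"
  assumes "R \<in> End_V" and "has_matrix R M"
  shows
    "((\<forall>i j. i \<noteq> j \<longrightarrow> M $ i $ j = 0) \<longrightarrow>
       (constant_R_deformation R \<longleftrightarrow> (\<exists>a b. M = diag3 a b a \<or> M = diag3 a b (- a)))) \<and>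
     (M $ 2 $ 1 = 0 \<and> M $ 3 $ 1 = 0 \<and> M $ 3 $ 2 = 0 \<longrightarrow>
       (jacobi (R_bracket R) \<longleftrightarrow>
          (M $ 1 $ 1)\<^sup>2 = (M $ 3 $ 3)\<^sup>2 \<and>
          M $ 1 $ 2 * (M $ 1 $ 1 + M $ 2 $ 2) = 0 \<and>
          M $ 2 $ 3 * (M $ 2 $ 2 + M $ 3 $ 3) = 0) \<and>
       ((M $ 1 $ 1)\<^sup>2 = (M $ 3 $ 3)\<^sup>2 \<and>
          M $ 1 $ 2 * (M $ 1 $ 1 + M $ 2 $ 2) = 0 \<and>
          M $ 2 $ 3 * (M $ 2 $ 2 + M $ 3 $ 3) = 0 \<longrightarrow> constant_R_deformation R)) \<and>
     (M $ 1 $ 2 = 0 \<and> M $ 2 $ 1 = 0 \<and> M $ 2 $ 3 = 0 \<and> M $ 3 $ 2 = 0 \<longrightarrow>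
       (constant_R_deformation R \<longleftrightarrow> M $ 1 $ 1 = M $ 3 $ 3 \<or> M $ 1 $ 1 = - M $ 3 $ 3)) \<and>
     (M $ 1 $ 2 = 0 \<and> M $ 2 $ 1 = 0 \<and> M $ 2 $ 3 = 0 \<and> M $ 3 $ 2 = 0 \<and>
       M $ 1 $ 1 = M $ 3 $ 3 \<longrightarrow> compatible_pencil W_bracket (R_bracket R))"
proof -
  note J = jacobi_R_bracket_iff[OF assms(2)]
  \<comment> \<open>The R-bracket is a skew biderivation for every \<open>R\<close>, so only the
    Jacobi identity is at stake.\<close>
  have C: "constant_R_deformation R \<longleftrightarrow> jacobi (R_bracket R)"
    by (simp add: constant_R_deformation_def poisson_def skew_biderivation_R_bracket)
  have I: "constant_R_deformation R \<longleftrightarrow> (\<exists>a b. M = diag3 a b a \<or> M = diag3 a b (- a))"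
    if D: "\<And>i j. i \<noteq> j \<Longrightarrow> M $ i $ j = 0"
  proof -
    have "(\<exists>a b. M = diag3 a b a \<or> M = diag3 a b (- a)) \<longleftrightarrow>
        M $ 1 $ 1 = M $ 3 $ 3 \<or> M $ 1 $ 1 = - M $ 3 $ 3"
      by (rule diag3_iff) (rule D)
    then show ?thesis by (simp add: C J D power2_eq_iff)
  qed
  \<comment> \<open>The zero entries of each type collapse the five equations, and
    \<open>power2_eq_iff\<close> splits equal squares into the two signs.\<close>
  show ?thesis
    using I compatible_pencil_R_bracket[OF assms(2)]
    by (auto simp: C J power2_eq_iff)
qed

end
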